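(* Let $s\ge 1$ be an integer and $\sigma>0$. Let $g(x)=\frac{1}{\sigma\sqrt{2\pi}}e^{-x^2/(2\sigma^2)}$ be the Gaussian density and define $$\bar\tau_{s,g}(x)=\begin{cases}\frac{1}{\sqrt2\,\sigma}\, e^{-x^2/(4\sigma^2)} & \text{if } |x|\ge 6\sqrt2\,\sigma\sqrt{s},\\[2pt] \frac{1}{\sqrt2\,\sigma}\, e\cdot s & \text{if } |x|\le 6\sqrt2\,\sigma\sqrt{s}.\end{cases}$$ Then $\tau_{s,g}(x)\le\bar\tau_{s,g}(x)$ for all $x\in\mathbb{R}$, and $\int_{-\infty}^{\infty}\bar\tau_{s,g}(x)\,dx=O(s^{3/2})$ (with an absolute implied constant, independent of $\sigma$).
   Context: For a probability density $p$ on $\mathbb{R}$ and $f:\mathbb{R}\to\mathbb{C}$, write $\|f\|_p^2=\int_{\mathbb{R}}|f(y)|^2p(y)\,dy$. Let $\mathcal{T}_s=\{f(x)=\sum_{j=1}^s a_je^{i\lambda_jx}: a_j\in\mathbb{C},\ \lambda_j\in\mathbb{R}\}$ be the class of $s$-sparse Fourier functions. The Fourier sparse leverage score is $\tau_{s,p}(x)=\sup_{f\in\mathcal{T}_s,\ \|f\|_p\neq 0}\frac{|f(x)|^2p(x)}{\|f\|_p^2}$. *)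

theory Defs
  imports "HOL-Probability.Probability"
begin

definition weighted_norm :: "(real \<Rightarrow> real) \<Rightarrow> (real \<Rightarrow> complex) \<Rightarrow> real" where
  "weighted_norm p f = sqrt (LINT y|lborel. (cmod (f y))\<^sup>2 * p y)"

definition sparse_fourier :: "nat \<Rightarrow> (real \<Rightarrow> complex) set" where
  "sparse_fourier s =
     {f. \<exists>(a :: nat \<Rightarrow> complex) (l :: nat \<Rightarrow> real).
           f = (\<lambda>x. \<Sum>j=1..s. a j * exp (\<i> * of_real (l j * x)))}"

text \<open>The supremum is taken in the extended reals, so that an upper bound on the score
  includes the claim that the supremum is finite.\<close>

definition leverage_score :: "nat \<Rightarrow> (real \<Rightarrow> real) \<Rightarrow> real \<Rightarrow> ereal" where
  "leverage_score s p x =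
     (SUP f \<in> {f \<in> sparse_fourier s. weighted_norm p f \<noteq> 0}.
        ereal ((cmod (f x))\<^sup>2 * p x / (weighted_norm p f)\<^sup>2))"

text \<open>At the common endpoint of the two ranges the smaller of the two values is used, so
  that an upper bound by this function implies the bound by either branch there.\<close>

definition gauss_score_bound :: "nat \<Rightarrow> real \<Rightarrow> real \<Rightarrow> real" where
  "gauss_score_bound s \<sigma> x =
     (if \<bar>x\<bar> \<ge> 6 * sqrt 2 * \<sigma> * sqrt (real s)
      then 1 / (sqrt 2 * \<sigma>) * exp (- x\<^sup>2 / (4 * \<sigma>\<^sup>2))
      else 1 / (sqrt 2 * \<sigma>) * (exp 1 * real s))"

end

theory Submission
  imports Defs
begin

text \<open>
  An \<open>s\<close>-dimensional space of continuous functions on an interval of length \<open>h\<close> has a reproducing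
  kernel whose diagonal integrates to at most \<open>s\<close>, so at some point \<open>x0\<close> every \<open>f\<close> in the space
  satisfies \<open>|f x0|^2 \<le> s/h \<integral>|f|^2\<close>. The span of finitely many complex exponentials is translation
  invariant, so \<open>x0\<close> may be moved to \<open>0\<close> at the cost of integrating over \<open>[-h, h]\<close>. Applied to
  \<open>u \<mapsto> f (x + u) exp (- x u / h^2)\<close> with \<open>h = sqrt 2 \<sigma>\<close>, whose exponential factor turns the Gaussian
  weight at \<open>0\<close> into the one at \<open>x\<close>, this gives the bound \<open>e s / (sqrt 2 \<sigma>)\<close> for every \<open>x\<close>.

  For large \<open>|x|\<close>, Turan's first main theorem along the progression \<open>x - k x / n\<close> with
  \<open>n \<approx> |x| sqrt s / h\<close> bounds \<open>|f x|\<close> by \<open>2^(s + n)\<close> times the values of \<open>|f|\<close> at \<open>s\<close> points in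
  \<open>[-h sqrt s, h sqrt s]\<close>, which are controlled by the first bound. This growth is dominated by half of
  the Gaussian exponent as soon as \<open>|x| \<ge> 6 h sqrt s\<close>.
\<close>

section \<open>Reproducing kernels of finite-dimensional function spaces\<close>

text \<open>Gram-Schmidt in \<open>L^2\<close> of the interval, by induction on \<open>s\<close>.
  The \<open>\<phi> j\<close> may be linearly dependent, which is why the basis has some length
  \<open>r \<le> s\<close>.\<close>

lemma orthonormal_basis_of_continuous_functions:
  fixes \<phi> :: "nat \<Rightarrow> real \<Rightarrow> complex"
  assumes ab: "a < b" and cont: "\<And>j. continuous_on {a..b} (\<phi> j)"
  shows "\<exists>r\<le>s. \<exists>q. (\<forall>k<r. continuous_on {a..b} (q k)) \<and>
           (\<forall>k<r. \<forall>l<r. integral {a..b} (\<lambda>x. q k x * cnj (q l x)) = (if k = l then 1 else 0)) \<and>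
           (\<forall>c. \<exists>d. \<forall>x\<in>{a..b}. (\<Sum>j<s. c j * \<phi> j x) = (\<Sum>k<r. d k * q k x))"
proof (induction s)
  case 0
  show ?case by (rule exI[of _ 0]) auto
next
  case (Suc s)
  then obtain r q where r: "r \<le> s" and qc: "\<forall>k<r. continuous_on {a..b} (q k)"
    and on: "\<forall>k<r. \<forall>l<r.
        integral {a..b} (\<lambda>x. q k x * cnj (q l x)) = (if k = l then 1 else 0)"
    and span: "\<forall>c. \<exists>d. \<forall>x\<in>{a..b}. (\<Sum>j<s. c j * \<phi> j x) = (\<Sum>k<r. d k * q k x)"
    by blast
  note qc = qc[rule_format] and on = on[rule_format]
  define p where "p k = integral {a..b} (\<lambda>x. \<phi> s x * cnj (q k x))" for k
  define \<psi> where "\<psi> x = \<phi> s x - (\<Sum>k<r. p k * q k x)" for x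
  define N where "N = integral {a..b} (\<lambda>x. (cmod (\<psi> x))\<^sup>2)"
  have \<psi>c: "continuous_on {a..b} \<psi>"
    unfolding \<psi>_def by (intro continuous_intros cont qc) auto
  have orth: "integral {a..b} (\<lambda>x. \<psi> x * cnj (q l x)) = 0" if l: "l < r" for l
  proof -
    have "integral {a..b} (\<lambda>x. \<psi> x * cnj (q l x)) =
        integral {a..b} (\<lambda>x. \<phi> s x * cnj (q l x) - (\<Sum>k<r. p k * (q k x * cnj (q l x))))"
      by (simp add: \<psi>_def algebra_simps sum_distrib_left)
    also have "\<dots> = p l - (\<Sum>k<r. p k * integral {a..b} (\<lambda>x. q k x * cnj (q l x)))"
    proof -
      have "integral {a..b} (\<lambda>x. \<Sum>k<r. p k * (q k x * cnj (q l x))) =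
          (\<Sum>k<r. integral {a..b} (\<lambda>x. p k * (q k x * cnj (q l x))))"
        using l by (intro Henstock_Kurzweil_Integration.integral_sum integrable_continuous_interval
            continuous_intros qc) auto
      then show ?thesis
        using l unfolding p_def
        by (subst Henstock_Kurzweil_Integration.integral_diff)
           (auto intro!: integrable_continuous_interval continuous_intros cont qc)
    qed
    also have "(\<Sum>k<r. p k * integral {a..b} (\<lambda>x. q k x * cnj (q l x))) =
        (\<Sum>k<r. if k = l then p k else 0)"
      using l by (intro sum.cong) (auto simp: on)
    finally show ?thesis using l by simp
  qed
  have orth': "integral {a..b} (\<lambda>x. q l x * cnj (\<psi> x)) = 0" if l: "l < r" for l
  proof -
    have "integral {a..b} (\<lambda>x. q l x * cnj (\<psi> x)) = cnj (integral {a..b} (\<lambda>x. \<psi> x * cnj (q l x)))"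
      by (simp add: Henstock_Kurzweil_Integration.integral_cnj mult.commute)
    then show ?thesis using orth[OF l] by simp
  qed
  have N0: "N \<ge> 0" unfolding N_def
    by (intro Henstock_Kurzweil_Integration.integral_nonneg)
       (auto intro!: integrable_continuous_interval continuous_intros \<psi>c)
  show ?case
  proof (cases "N = 0")
    case True
    \<comment> \<open>A continuous nonnegative function with zero integral vanishes, so
      \<open>\<phi> s\<close> already lies in the span and the basis is kept.\<close>
    then have "\<forall>x\<in>{a..b}. (cmod (\<psi> x))\<^sup>2 = 0"
      unfolding N_def by (subst (asm) integral_eq_0_iff) (auto intro!: continuous_intros \<psi>c ab)
    then have \<phi>s: "\<phi> s x = (\<Sum>k<r. p k * q k x)" if "x \<in> {a..b}" for x
      using that by (auto simp: \<psi>_def)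
    have "\<exists>d. \<forall>x\<in>{a..b}. (\<Sum>j<Suc s. c j * \<phi> j x) = (\<Sum>k<r. d k * q k x)" for c
    proof -
      obtain d where "\<forall>x\<in>{a..b}. (\<Sum>j<s. c j * \<phi> j x) = (\<Sum>k<r. d k * q k x)"
        using span by blast
      then show ?thesis
        by (intro exI[of _ "\<lambda>k. d k + c s * p k"])
           (auto simp: \<phi>s sum_distrib_left sum.distrib algebra_simps)
    qed
    then show ?thesis using r qc on by (intro exI[of _ r]) (auto intro!: exI[of _ q])
  next
    case False
    with N0 have N: "N > 0" by simp
    define e where "e = complex_of_real (1 / sqrt N)"
    define q' where "q' = q(r := (\<lambda>x. e * \<psi> x))"
    have q'_less: "q' k = q k" if "k < r" for k using that by (simp add: q'_def)
    have q'_r: "q' r = (\<lambda>x. e * \<psi> x)" by (simp add: q'_def)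
    have "integral {a..b} (\<lambda>x. \<psi> x * cnj (\<psi> x)) = integral {a..b} (\<lambda>x. complex_of_real ((cmod (\<psi> x))\<^sup>2))"
      by (simp add: complex_norm_square del: of_real_power)
    also have "\<dots> = of_real N"
      unfolding N_def
      by (intro integral_unique has_integral_of_real integrable_integral integrable_continuous_interval
            continuous_intros \<psi>c)
    finally have "integral {a..b} (\<lambda>x. \<psi> x * cnj (\<psi> x)) = of_real N" .
    moreover have "integral {a..b} (\<lambda>x. q' r x * cnj (q' r x)) =
        e * cnj e * integral {a..b} (\<lambda>x. \<psi> x * cnj (\<psi> x))"
      unfolding q'_r Henstock_Kurzweil_Integration.integral_mult_right[symmetric] by (simp add: algebra_simps)
    moreover have "e * cnj e * of_real N = 1"
      using N by (simp add: e_def flip: of_real_mult)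
    ultimately have nr: "integral {a..b} (\<lambda>x. q' r x * cnj (q' r x)) = 1" by simp
    have o1: "integral {a..b} (\<lambda>x. q' r x * cnj (q' l x)) = 0" if "l < r" for l
    proof -
      have "integral {a..b} (\<lambda>x. q' r x * cnj (q' l x)) = e * integral {a..b} (\<lambda>x. \<psi> x * cnj (q l x))"
        unfolding q'_r q'_less[OF that] Henstock_Kurzweil_Integration.integral_mult_right[symmetric]
        by (simp add: algebra_simps)
      then show ?thesis by (simp add: orth that)
    qed
    have o2: "integral {a..b} (\<lambda>x. q' l x * cnj (q' r x)) = 0" if "l < r" for l
    proof -
      have "integral {a..b} (\<lambda>x. q' l x * cnj (q' r x)) = cnj e * integral {a..b} (\<lambda>x. q l x * cnj (\<psi> x))"
        unfolding q'_r q'_less[OF that] Henstock_Kurzweil_Integration.integral_mult_right[symmetric]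
        by (simp add: algebra_simps)
      then show ?thesis by (simp add: orth' that)
    qed
    have on': "integral {a..b} (\<lambda>x. q' k x * cnj (q' l x)) = (if k = l then 1 else 0)"
      if "k < Suc r" "l < Suc r" for k l
      using that o1 o2 on by (auto simp: less_Suc_eq nr q'_less)
    have "\<exists>d. \<forall>x\<in>{a..b}. (\<Sum>j<Suc s. c j * \<phi> j x) = (\<Sum>k<Suc r. d k * q' k x)" for c
    proof -
      obtain d where d: "\<forall>x\<in>{a..b}. (\<Sum>j<s. c j * \<phi> j x) = (\<Sum>k<r. d k * q k x)"
        using span by blast
      have "\<phi> s x = (\<Sum>k<r. p k * q k x) + \<psi> x" for x
        by (simp add: \<psi>_def)
      moreover have "of_real (sqrt N) * (e * z) = z" for z
        using N by (simp add: e_def)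
      \<comment> \<open>The new basis vector is \<open>\<psi>\<close> divided by
        \<open>sqrt N\<close>, hence the coefficient \<open>c s * sqrt N\<close> at position
        \<open>r\<close>.\<close>
      ultimately show ?thesis using d
        by (intro exI[of _ "\<lambda>k. if k < r then d k + c s * p k else c s * of_real (sqrt N)"])
           (auto simp: q'_less q'_r sum_distrib_left sum.distrib algebra_simps)
    qed
    moreover have "continuous_on {a..b} (q' k)" if "k < Suc r" for k
      using that by (auto simp: less_Suc_eq q'_less q'_r intro!: continuous_intros qc \<psi>c)
    ultimately show ?thesis using r on' by (intro exI[of _ "Suc r"]) (auto intro!: exI[of _ q'])
  qed
qed

text \<open>The diagonal \<open>K\<close> of the reproducing kernel has integral
  \<open>r \<le> s\<close>, so its minimum, attained at \<open>x0\<close>, is at most the mean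
  \<open>s / (b - a)\<close>. Cauchy-Schwarz and Parseval then bound every combination at this one
  point, which does not depend on \<open>c\<close>.\<close>

lemma exists_point_bounding_span:
  fixes \<phi> :: "nat \<Rightarrow> real \<Rightarrow> complex"
  assumes ab: "a < b" and cont: "\<And>j. continuous_on {a..b} (\<phi> j)"
  shows "\<exists>x0\<in>{a..b}. \<forall>c. (cmod (\<Sum>j<s. c j * \<phi> j x0))\<^sup>2 \<le>
           real s / (b - a) * integral {a..b} (\<lambda>x. (cmod (\<Sum>j<s. c j * \<phi> j x))\<^sup>2)"
proof -
  obtain r q where r: "r \<le> s" and qc: "\<forall>k<r. continuous_on {a..b} (q k)"
    and on: "\<forall>k<r. \<forall>l<r.
        integral {a..b} (\<lambda>x. q k x * cnj (q l x)) = (if k = l then 1 else 0)"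
    and span: "\<forall>c. \<exists>d. \<forall>x\<in>{a..b}. (\<Sum>j<s. c j * \<phi> j x) = (\<Sum>k<r. d k * q k x)"
    using orthonormal_basis_of_continuous_functions[of a b \<phi> s, OF assms]
    by blast
  note qc = qc[rule_format] and on = on[rule_format]
  define K where "K x = (\<Sum>k<r. (cmod (q k x))\<^sup>2)" for x
  have Kc: "continuous_on {a..b} K"
    unfolding K_def by (intro continuous_intros qc) auto
  have parseval: "integral {a..b} (\<lambda>x. (cmod (\<Sum>k<r. d k * q k x))\<^sup>2) = (\<Sum>k<r. (cmod (d k))\<^sup>2)" for d
  proof -
    have "complex_of_real (integral {a..b} (\<lambda>x. (cmod (\<Sum>k<r. d k * q k x))\<^sup>2)) =
        integral {a..b} (\<lambda>x. complex_of_real ((cmod (\<Sum>k<r. d k * q k x))\<^sup>2))"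
      by (rule integral_unique[symmetric], intro has_integral_of_real integrable_integral 
          integrable_continuous_interval continuous_intros qc) auto
    also have "\<dots> = integral {a..b} (\<lambda>x. \<Sum>k<r. \<Sum>l<r. d k * cnj (d l) * (q k x * cnj (q l x)))"
      by (simp add: complex_norm_square sum_product algebra_simps del: of_real_power)
    also have "\<dots> = (\<Sum>k<r. \<Sum>l<r. d k * cnj (d l) * integral {a..b} (\<lambda>x. q k x * cnj (q l x)))"
    proof -
      have "integral {a..b} (\<lambda>x. \<Sum>k<r. \<Sum>l<r. d k * cnj (d l) * (q k x * cnj (q l x))) =
          (\<Sum>k<r. integral {a..b} (\<lambda>x. \<Sum>l<r. d k * cnj (d l) * (q k x * cnj (q l x))))"
        by (intro Henstock_Kurzweil_Integration.integral_sum integrable_continuous_interval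
            continuous_intros qc) auto
      also have "\<dots> = (\<Sum>k<r. \<Sum>l<r. integral {a..b} (\<lambda>x. d k * cnj (d l) * (q k x * cnj (q l x))))"
        by (intro sum.cong refl Henstock_Kurzweil_Integration.integral_sum
            integrable_continuous_interval continuous_intros qc) auto
      finally show ?thesis by simp
    qed
    also have "\<dots> = (\<Sum>k<r. \<Sum>l<r. if l = k then d k * cnj (d l) else 0)"
      by (intro sum.cong refl) (auto simp: on)
    also have "\<dots> = complex_of_real (\<Sum>k<r. (cmod (d k))\<^sup>2)"
      by (simp add: complex_norm_square del: of_real_power)
    finally show ?thesis by (simp only: of_real_eq_iff)
  qed
  have q2: "integral {a..b} (\<lambda>x. (cmod (q k x))\<^sup>2) = 1" if "k < r" for k
  proof -
    \<comment> \<open>Parseval for the \<open>k\<close>-th unit coefficient vector.\<close>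
    have "integral {a..b} (\<lambda>x. (cmod (\<Sum>l<r. (if l = k then 1 else 0) * q l x))\<^sup>2) =
          (\<Sum>l<r. (cmod (if l = k then 1 else 0))\<^sup>2)" by (rule parseval)
    moreover have "(\<Sum>l<r. (if l = k then 1 else 0) * q l x) = q k x" for x
      using that by (simp add: if_distrib[of "\<lambda>z. z * _"] cong: if_cong)
    moreover have "(\<Sum>l<r. (cmod (if l = k then 1 else 0))\<^sup>2) = 1"
      using that by (simp add: if_distrib[of cmod] if_distrib[of "\<lambda>z. z ^ 2"] cong: if_cong)
    ultimately show ?thesis by simp
  qed
  have "integral {a..b} K = (\<Sum>k<r. integral {a..b} (\<lambda>x. (cmod (q k x))\<^sup>2))"
    unfolding K_def by (intro Henstock_Kurzweil_Integration.integral_sum)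
      (auto intro!: integrable_continuous_interval continuous_intros qc)
  also have "\<dots> = real r" by (simp add: q2)
  finally have IK: "integral {a..b} K = real r" .
  obtain x0 where x0: "x0 \<in> {a..b}" and min: "\<And>x. x \<in> {a..b} \<Longrightarrow> K x0 \<le> K x"
    using continuous_attains_inf[OF _ _ Kc] ab by auto
  have "integral {a..b} (\<lambda>x. K x0) \<le> integral {a..b} K"
    by (intro integral_le) (auto intro!: integrable_continuous_interval Kc min)
  then have "(b - a) * K x0 \<le> real s"
    using IK ab r by simp
  then have K0: "K x0 \<le> real s / (b - a)"
    using ab by (simp add: field_simps)
  have "(cmod (\<Sum>j<s. c j * \<phi> j x0))\<^sup>2 \<le>
           real s / (b - a) * integral {a..b} (\<lambda>x. (cmod (\<Sum>j<s. c j * \<phi> j x))\<^sup>2)" for c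
  proof -
    obtain d where d: "\<And>x. x \<in> {a..b} \<Longrightarrow> (\<Sum>j<s. c j * \<phi> j x) = (\<Sum>k<r. d k * q k x)"
      using span by blast
    have I: "integral {a..b} (\<lambda>x. (cmod (\<Sum>j<s. c j * \<phi> j x))\<^sup>2) = (\<Sum>k<r. (cmod (d k))\<^sup>2)"
      unfolding parseval[symmetric] by (intro Henstock_Kurzweil_Integration.integral_cong) (simp add: d)
    have "cmod (\<Sum>j<s. c j * \<phi> j x0) \<le> (\<Sum>k<r. cmod (d k) * cmod (q k x0))"
      unfolding d[OF x0] by (rule order_trans[OF norm_sum]) (simp add: norm_mult)
    then have "(cmod (\<Sum>j<s. c j * \<phi> j x0))\<^sup>2 \<le> (\<Sum>k<r. cmod (d k) * cmod (q k x0))\<^sup>2"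
      by (intro power_mono) auto
    also have "\<dots> \<le> (\<Sum>k<r. (cmod (d k))\<^sup>2) * K x0"
      unfolding K_def by (rule Cauchy_Schwarz_ineq_sum)
    also have "\<dots> \<le> (\<Sum>k<r. (cmod (d k))\<^sup>2) * (real s / (b - a))"
      by (intro mult_left_mono K0 sum_nonneg) auto
    finally show ?thesis unfolding I by (simp add: mult.commute)
  qed
  with x0 show ?thesis by blast
qed

text \<open>The left side is the value at \<open>u = 0\<close>. The exponents
  \<open>\<zeta> j\<close> are arbitrary complex numbers so that a real exponential factor can later
  be absorbed into them.\<close>

lemma exponential_sum_bound:
  fixes a \<zeta> :: "nat \<Rightarrow> complex"
  assumes h: "h > 0"
  shows "(cmod (\<Sum>j<s. a j))\<^sup>2 \<le>
           real s / h * integral {-h..h} (\<lambda>u. (cmod (\<Sum>j<s. a j * exp (\<zeta> j * of_real u)))\<^sup>2)"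
proof -
  define f where "f u = (\<Sum>j<s. a j * exp (\<zeta> j * of_real u))" for u :: real
  have fc: "continuous_on A (\<lambda>u. (cmod (f u))\<^sup>2)" for A
    unfolding f_def by (intro continuous_intros)
  have "\<exists>x0\<in>{0..h}. \<forall>c. (cmod (\<Sum>j<s. c j * exp (\<zeta> j * of_real x0)))\<^sup>2 \<le>
           real s / (h - 0) * integral {0..h} (\<lambda>x. (cmod (\<Sum>j<s. c j * exp (\<zeta> j * of_real x)))\<^sup>2)"
    using h by (intro exists_point_bounding_span continuous_intros) auto
  then obtain x0 where x0: "x0 \<in> {0..h}" and
    bd: "\<And>c. (cmod (\<Sum>j<s. c j * exp (\<zeta> j * of_real x0)))\<^sup>2 \<le>
           real s / h * integral {0..h} (\<lambda>x. (cmod (\<Sum>j<s. c j * exp (\<zeta> j * of_real x)))\<^sup>2)"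
    by auto
  \<comment> \<open>Translation only rescales the coefficients, and \<open>bd\<close> holds for all
    coefficients. The window becomes \<open>[-x0, h - x0]\<close>, which lies in
    \<open>[-h, h]\<close> wherever \<open>x0\<close> is in \<open>[0, h]\<close>.\<close>
  have shift: "(\<Sum>j<s. a j * exp (- \<zeta> j * of_real x0) * exp (\<zeta> j * of_real x)) = f (x - x0)" for x
    unfolding f_def by (simp add: exp_diff exp_minus algebra_simps divide_inverse)
  have "(cmod (f (x0 - x0)))\<^sup>2 \<le> real s / h * integral {0..h} (\<lambda>x. (cmod (f (x - x0)))\<^sup>2)"
    using bd[of "\<lambda>j. a j * exp (- \<zeta> j * of_real x0)"] unfolding shift .
  also have "integral {0..h} (\<lambda>x. (cmod (f (x - x0)))\<^sup>2) = integral {0 - x0..h - x0} (\<lambda>x. (cmod (f x))\<^sup>2)"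
    using integral_shift_real_ivl[of "0 - x0" "-x0" "h - x0" "\<lambda>x. (cmod (f x))\<^sup>2"] by simp
  also have "\<dots> \<le> integral {-h..h} (\<lambda>x. (cmod (f x))\<^sup>2)"
    using x0 by (intro integral_subset_le integrable_continuous_interval fc) auto
  finally show ?thesis using h by (simp add: f_def divide_right_mono mult_left_mono)
qed

section \<open>Turan's first main theorem\<close>

text \<open>In the step from \<open>s\<close> to \<open>s + 1\<close>, write \<open>u k\<close> for the sum with \<open>b j\<close> replaced by \<open>b j * w j ^ k\<close>. The differences
  \<open>u k - u (k + 1) / w s\<close> lack the frequency \<open>w s\<close>, and \<open>u 0\<close> telescopes into those with \<open>k \<le> m\<close>
  and \<open>u (m + 1)\<close>. The summand \<open>-1\<close> in the bound is what makes the induction close.\<close>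

lemma turan_first_main_theorem:
  fixes b w :: "nat \<Rightarrow> complex"
  assumes "\<And>j. j < s \<Longrightarrow> cmod (w j) = 1" and "0 \<le> M"
    and "\<And>k. m < k \<Longrightarrow> k \<le> m + s \<Longrightarrow> cmod (\<Sum>j<s. b j * w j ^ k) \<le> M"
  shows "cmod (\<Sum>j<s. b j) \<le> (2 ^ s * real ((m + s) choose s) - 1) * M"
  using assms
proof (induction s arbitrary: b m M)
  case 0
  then show ?case by simp
next
  case (Suc s)
  define u where "u k = (\<Sum>j<Suc s. b j * w j ^ k)" for k
  define v where "v = 1 / w s"
  have v: "cmod v = 1" "v * w s = 1"
    using Suc.prems(1)[of s] by (auto simp: v_def norm_divide)
  have uM: "cmod (u k) \<le> M" if "m < k" "k \<le> m + Suc s" for k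
    using Suc.prems(3)[OF that] by (simp add: u_def)
  define d where "d k = u k - v * u (Suc k)" for k
  have d_eq: "d k = (\<Sum>j<s. b j * (1 - v * w j) * w j ^ k)" for k
    using v(2) unfolding d_def u_def
    by (simp add: sum_distrib_left algebra_simps sum_subtractf)
  have dM: "cmod (d k) \<le> 2 * M" if "m < k" "k \<le> m + s" for k
  proof -
    have "cmod (d k) \<le> cmod (u k) + cmod (v * u (Suc k))"
      unfolding d_def by (rule norm_triangle_ineq4)
    also have "\<dots> \<le> M + M" using that by (intro add_mono) (auto simp: norm_mult v uM)
    finally show ?thesis by simp
  qed
  \<comment> \<open>Absorbing \<open>w j ^ i\<close> into the coefficients shortens the gap to
    \<open>m - i\<close>: for \<open>m - i < k \<le> m - i + s\<close> the index
    \<open>i + k\<close> stays in the window where \<open>dM\<close> applies.\<close>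
  have di: "cmod (d i) \<le> (2 ^ s * real ((m - i + s) choose s) - 1) * (2 * M)" if i: "i \<le> m" for i
  proof -
    have eq: "(\<Sum>j<s. b j * (1 - v * w j) * w j ^ i * w j ^ k) = d (i + k)" for k
      by (simp add: d_eq power_add mult.assoc)
    have "cmod (\<Sum>j<s. b j * (1 - v * w j) * w j ^ i) \<le> (2 ^ s * real ((m - i + s) choose s) - 1) * (2 * M)"
      using Suc.prems(1,2) i by (intro Suc.IH) (auto simp: eq intro!: dM)
    then show ?thesis by (simp add: d_eq)
  qed
  have telescope: "u 0 = (\<Sum>i<n. v ^ i * d i) + v ^ n * u n" for n
    by (induction n) (simp_all add: d_def algebra_simps)
  have "cmod (u 0) \<le> (\<Sum>i<Suc m. cmod (v ^ i * d i)) + cmod (v ^ Suc m * u (Suc m))"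
    unfolding telescope[of "Suc m"] by (intro norm_triangle_le add_mono norm_sum order_refl)
  also have "\<dots> \<le> (\<Sum>i<Suc m. (2 ^ s * real ((m - i + s) choose s) - 1) * (2 * M)) + M"
    using di uM[of "Suc m"]
    by (intro add_mono sum_mono) (auto simp: norm_mult norm_power v simp del: power_Suc)
  also have "(\<Sum>i<Suc m. (2 ^ s * real ((m - i + s) choose s) - 1) * (2 * M)) =
      (2 ^ s * (\<Sum>i<Suc m. real ((m - i + s) choose s)) - real (Suc m)) * (2 * M)"
    by (simp add: sum_distrib_left sum_distrib_right sum_subtractf algebra_simps)
  also have "(\<Sum>i<Suc m. real ((m - i + s) choose s)) = (\<Sum>i\<le>m. real ((s + i) choose s))"
    by (subst sum.nat_diff_reindex[symmetric]) (simp add: lessThan_Suc_atMost add.commute)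
  \<comment> \<open>Hockey-stick identity for binomial coefficients.\<close>
  also have "\<dots> = real ((m + Suc s) choose Suc s)"
    using choose_rising_sum(1)[of s m] by (simp add: add.commute flip: of_nat_sum)
  \<comment> \<open>The \<open>m + 1\<close> summands \<open>-1\<close> contribute
    \<open>-2 (m + 1) M\<close>. This absorbs the remainder \<open>M\<close> from
    \<open>u (m + 1)\<close> and still leaves the \<open>-M\<close> required.\<close>
  also have "(2 ^ s * real ((m + Suc s) choose Suc s) - real (Suc m)) * (2 * M) + M
      = (2 ^ Suc s * real ((m + Suc s) choose Suc s) - 1) * M - 2 * real m * M"
    by (simp add: algebra_simps)
  also have "\<dots> \<le> (2 ^ Suc s * real ((m + Suc s) choose Suc s) - 1) * M"
    using Suc.prems(2) by simp
  finally show ?case by (simp add: u_def)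
qed

section \<open>Sparse Fourier functions and the Gaussian norm\<close>

lemma sparse_fourierE:
  assumes "f \<in> sparse_fourier s"
  obtains a l where "f = (\<lambda>x. \<Sum>j<s. a j * exp (\<i> * of_real (l j * x)))"
proof -
  obtain a l where "f = (\<lambda>x. \<Sum>j=1..s. a j * exp (\<i> * of_real (l j * x)))"
    using assms unfolding sparse_fourier_def by blast
  then have "f = (\<lambda>x. \<Sum>j<s. a (Suc j) * exp (\<i> * of_real (l (Suc j) * x)))"
    by (simp add: sum.atLeast1_atMost_eq)
  then show ?thesis by (rule that)
qed

lemma continuous_on_sparse_fourier:
  assumes "f \<in> sparse_fourier s"
  shows "continuous_on A f"
  using assms unfolding sparse_fourier_def by (auto intro!: continuous_intros)

lemma sparse_fourier_bounded:
  assumes "f \<in> sparse_fourier s"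
  obtains B where "\<And>x. cmod (f x) \<le> B"
proof -
  obtain a l where f: "f = (\<lambda>x. \<Sum>j<s. a j * exp (\<i> * of_real (l j * x)))"
    using assms by (rule sparse_fourierE)
  have "cmod (f x) \<le> (\<Sum>j<s. cmod (a j))" for x
    unfolding f by (rule order_trans[OF norm_sum]) (simp add: norm_mult)
  then show ?thesis by (rule that)
qed

lemma integrable_sparse_fourier_normal_density:
  assumes "f \<in> sparse_fourier s" and "\<sigma> > 0"
  shows "integrable lborel (\<lambda>y. (cmod (f y))\<^sup>2 * normal_density 0 \<sigma> y)"
proof -
  obtain B where B: "\<And>x. cmod (f x) \<le> B"
    using sparse_fourier_bounded[OF assms(1)] by blast
  have [measurable]: "f \<in> borel_measurable borel"
    by (intro borel_measurable_continuous_onI continuous_on_sparse_fourier[OF assms(1)])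
  have "integrable lborel (\<lambda>y. B\<^sup>2 * normal_density 0 \<sigma> y)"
    using assms(2) by (intro integrable_mult_right) auto
  then show ?thesis
  proof (rule Bochner_Integration.integrable_bound)
    show "AE y in lborel. norm ((cmod (f y))\<^sup>2 * normal_density 0 \<sigma> y) \<le> norm (B\<^sup>2 * normal_density 0 \<sigma> y)"
      using B by (auto simp: abs_mult intro!: mult_right_mono power_mono)
  qed measurable
qed

lemma weighted_norm_squared:
  assumes "\<And>y. p y \<ge> 0"
  shows "(weighted_norm p f)\<^sup>2 = (LINT y|lborel. (cmod (f y))\<^sup>2 * p y)"
  unfolding weighted_norm_def using assms by (subst real_sqrt_pow2) (auto intro!: integral_nonneg_AE)

section \<open>Pointwise bounds in the centre and in the tail\<close>

text \<open>Valid for every \<open>x\<close>. It gives the central branch directly and also feeds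
  the tail estimate.\<close>

lemma sparse_fourier_central_bound:
  assumes f: "f \<in> sparse_fourier s" and \<sigma>: "\<sigma> > 0"
  shows "(cmod (f x))\<^sup>2 * normal_density 0 \<sigma> x \<le>
           exp 1 * real s / (sqrt 2 * \<sigma>) * (weighted_norm (normal_density 0 \<sigma>) f)\<^sup>2"
proof -
  obtain a l where f_eq: "f = (\<lambda>x. \<Sum>j<s. a j * exp (\<i> * of_real (l j * x)))"
    using f by (rule sparse_fourierE)
  \<comment> \<open>With this \<open>h\<close> the Gaussian is a multiple of
    \<open>exp (- y^2 / h^2)\<close>, and the loss \<open>exp (u^2 / h^2)\<close> is at most
    \<open>e\<close> on \<open>[-h, h]\<close>.\<close>
  define h where "h = sqrt 2 * \<sigma>"
  have h: "h > 0" and h2: "h\<^sup>2 = 2 * \<sigma>\<^sup>2" using \<sigma> by (auto simp: h_def power_mult_distrib)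
  define g where "g = normal_density 0 \<sigma>"
  have g: "g y = 1 / sqrt (pi * h\<^sup>2) * exp (- y\<^sup>2 / h\<^sup>2)" for y
    unfolding g_def normal_density_def h2 by (simp add: algebra_simps)
  have gc: "continuous_on A g" for A
    unfolding g using h by (intro continuous_intros) auto
  \<comment> \<open>The tilted translate of \<open>f\<close>, written as an exponential sum with
    complex exponents; \<open>F 0 = f x\<close>.\<close>
  define F where "F u = (\<Sum>j<s. a j * exp (\<i> * of_real (l j * x)) *
      exp ((\<i> * of_real (l j) - of_real (x / h\<^sup>2)) * of_real u))" for u :: real
  have F: "F u = f (x + u) * of_real (exp (- (x * u / h\<^sup>2)))" for u
    unfolding F_def f_eq sum_distrib_right
    by (simp add: exp_of_real[symmetric] mult.assoc exp_add[symmetric] algebra_simps)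
  have le: "(cmod (F u))\<^sup>2 * g x \<le> exp 1 * ((cmod (f (x + u)))\<^sup>2 * g (x + u))" if u: "u \<in> {-h..h}" for u
  proof -
    have "u\<^sup>2 \<le> h\<^sup>2" using u by (simp add: abs_le_square_iff[symmetric] abs_le_iff)
    then have u2: "u\<^sup>2 / h\<^sup>2 \<le> 1" using h by simp
    \<comment> \<open>Completing the square: \<open>- 2 x u - x^2 = u^2 - (x + u)^2\<close>.\<close>
    have "(exp (- (x * u / h\<^sup>2)))\<^sup>2 * exp (- x\<^sup>2 / h\<^sup>2) = exp (u\<^sup>2 / h\<^sup>2) * exp (- (x + u)\<^sup>2 / h\<^sup>2)"
      using h by (simp add: power2_eq_square exp_add[symmetric] field_simps)
    also have "\<dots> \<le> exp 1 * exp (- (x + u)\<^sup>2 / h\<^sup>2)"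
      using u2 by (intro mult_right_mono) auto
    finally have "(exp (- (x * u / h\<^sup>2)))\<^sup>2 * exp (- x\<^sup>2 / h\<^sup>2) \<le> exp 1 * exp (- (x + u)\<^sup>2 / h\<^sup>2)" .
    then have "(cmod (f (x + u)))\<^sup>2 / sqrt (pi * h\<^sup>2) * ((exp (- (x * u / h\<^sup>2)))\<^sup>2 * exp (- x\<^sup>2 / h\<^sup>2))
        \<le> (cmod (f (x + u)))\<^sup>2 / sqrt (pi * h\<^sup>2) * (exp 1 * exp (- (x + u)\<^sup>2 / h\<^sup>2))"
      by (intro mult_left_mono) auto
    then show ?thesis
      unfolding F g norm_mult power_mult_distrib norm_of_real by (simp add: mult_ac)
  qed
  have fc: "continuous_on A f" for A by (rule continuous_on_sparse_fourier[OF f])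
  have "(cmod (f x))\<^sup>2 \<le> real s / h * integral {-h..h} (\<lambda>u. (cmod (F u))\<^sup>2)"
    using exponential_sum_bound[OF h, where s = s and a = "\<lambda>j. a j * exp (\<i> * of_real (l j * x))"
        and \<zeta> = "\<lambda>j. \<i> * of_real (l j) - of_real (x / h\<^sup>2)"]
    unfolding F_def f_eq .
  then have "(cmod (f x))\<^sup>2 * g x \<le> real s / h * integral {-h..h} (\<lambda>u. (cmod (F u))\<^sup>2) * g x"
    by (intro mult_right_mono) (auto simp: g_def)
  also have "\<dots> = real s / h * integral {-h..h} (\<lambda>u. (cmod (F u))\<^sup>2 * g x)"
    by simp
  also have "\<dots> \<le> real s / h * integral {-h..h} (\<lambda>u. exp 1 * ((cmod (f (x + u)))\<^sup>2 * g (x + u)))"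
    using h le unfolding F
    by (intro mult_left_mono integral_le integrable_continuous_interval continuous_intros
         continuous_on_compose2[OF fc] continuous_on_compose2[OF gc]) auto
  also have "\<dots> = real s / h * (exp 1 * integral {x - h..x + h} (\<lambda>y. (cmod (f y))\<^sup>2 * g y))"
    using integral_shift_real_ivl[of "x - h" x "x + h" "\<lambda>y. (cmod (f y))\<^sup>2 * g y"]
    by (simp add: add.commute)
  also have "\<dots> \<le> real s / h * (exp 1 * (weighted_norm g f)\<^sup>2)"
  proof -
    have int: "integrable lborel (\<lambda>y. (cmod (f y))\<^sup>2 * g y)"
      unfolding g_def by (rule integrable_sparse_fourier_normal_density[OF f \<sigma>])
    then have si: "set_integrable lborel {x - h..x + h} (\<lambda>y. (cmod (f y))\<^sup>2 * g y)"
      unfolding set_integrable_def by (intro integrable_mult_indicator) auto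
    have "integral {x - h..x + h} (\<lambda>y. (cmod (f y))\<^sup>2 * g y) =
        (LINT y:{x - h..x + h}|lborel. (cmod (f y))\<^sup>2 * g y)"
      using set_borel_integral_eq_integral(2)[OF si] by simp
    also have "\<dots> \<le> (LINT y|lborel. (cmod (f y))\<^sup>2 * g y)"
      unfolding set_lebesgue_integral_def using int si
      by (intro integral_mono) (auto simp: set_integrable_def indicator_def g_def)
    also have "\<dots> = (weighted_norm g f)\<^sup>2"
      by (rule weighted_norm_squared[symmetric]) (simp add: g_def)
    finally show ?thesis using h by (intro mult_left_mono) auto
  qed
  finally show ?thesis by (simp add: g_def h_def mult_ac)
qed

text \<open>Extrapolation from the centre costs at most \<open>exp (4 s + 2 n)\<close> in
  \<open>|f x|^2\<close>, with \<open>n\<close> about \<open>K s\<close> and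
  \<open>K = |x| / (h sqrt s)\<close>. Half of the Gaussian exponent is \<open>K^2 s / 2\<close>,
  which wins once \<open>K \<ge> 6\<close>.\<close>

lemma sparse_fourier_tail_bound:
  assumes f: "f \<in> sparse_fourier s" and \<sigma>: "\<sigma> > 0" and s: "s \<ge> 1"
    and x: "\<bar>x\<bar> \<ge> 6 * sqrt 2 * \<sigma> * sqrt (real s)"
  shows "(cmod (f x))\<^sup>2 * normal_density 0 \<sigma> x \<le>
           1 / (sqrt 2 * \<sigma>) * exp (- x\<^sup>2 / (4 * \<sigma>\<^sup>2)) * (weighted_norm (normal_density 0 \<sigma>) f)\<^sup>2"
proof -
  obtain a l where f_eq: "f = (\<lambda>x. \<Sum>j<s. a j * exp (\<i> * of_real (l j * x)))"
    using f by (rule sparse_fourierE)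
  define h where "h = sqrt 2 * \<sigma>"
  have h: "h > 0" and h2: "h\<^sup>2 = 2 * \<sigma>\<^sup>2" using \<sigma> by (auto simp: h_def power_mult_distrib)
  define N where "N = (weighted_norm (normal_density 0 \<sigma>) f)\<^sup>2"
  have N: "N \<ge> 0" by (simp add: N_def)
  have g: "normal_density 0 \<sigma> y = 1 / (h * sqrt pi) * exp (- y\<^sup>2 / h\<^sup>2)" for y
  proof -
    have "sqrt (2 * pi * \<sigma>\<^sup>2) = h * sqrt pi" using \<sigma> by (simp add: h_def real_sqrt_mult)
    then show ?thesis unfolding normal_density_def h2 by simp
  qed
  define K where "K = \<bar>x\<bar> / (h * sqrt (real s))"
  have K: "K \<ge> 6"
    unfolding K_def using x h s by (subst pos_le_divide_eq) (simp_all add: h_def mult_ac \<sigma>)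
  have xK: "\<bar>x\<bar> = K * h * sqrt (real s)" using h s by (simp add: K_def)
  \<comment> \<open>With this many steps from \<open>x\<close> to \<open>0\<close>, the last
    \<open>s\<close> points lie within \<open>|x| s / n \<le> |x| / K = h sqrt s\<close> of the
    origin.\<close>
  define n where "n = nat \<lceil>K * real s\<rceil>"
  have n1: "K * real s \<le> real n" and n2: "real n \<le> K * real s + 1"
    using K s unfolding n_def by (auto simp: of_nat_nat intro: order_trans[OF _ real_nat_ceiling_ge])
  have sn: "s \<le> n"
  proof -
    have "real s \<le> K * real s" using K s by simp
    with n1 show ?thesis by linarith
  qed
  \<comment> \<open>One factor \<open>exp s\<close> bounds the constant \<open>e s\<close> of the
    central estimate, the other bounds the inverse weight \<open>exp (y^2 / h^2)\<close> for
    \<open>|y| \<le> h sqrt s\<close>.\<close>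
  define M where "M = sqrt (exp (2 * real s) * sqrt pi * N)"
  have M: "M \<ge> 0" "M\<^sup>2 = exp (2 * real s) * sqrt pi * N" using N by (auto simp: M_def)
  have s_exp: "exp 1 * real s \<le> exp (real s)"
    using exp_ge_add_one_self[of "real s - 1"] by (simp add: exp_diff field_simps)
  have small: "cmod (f y) \<le> M" if y: "\<bar>y\<bar> \<le> h * sqrt (real s)" for y
  proof -
    have "y\<^sup>2 \<le> (h * sqrt (real s))\<^sup>2" using y by (simp add: abs_le_square_iff[symmetric])
    then have y2: "y\<^sup>2 / h\<^sup>2 \<le> real s" using h by (simp add: power_mult_distrib field_simps)
    have "(cmod (f y))\<^sup>2 * (1 / (h * sqrt pi) * exp (- y\<^sup>2 / h\<^sup>2)) \<le> exp 1 * real s / h * N"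
      using sparse_fourier_central_bound[OF f \<sigma>, of y] unfolding g N_def h_def .
    then have "(cmod (f y))\<^sup>2 \<le> (exp 1 * real s) * exp (y\<^sup>2 / h\<^sup>2) * (sqrt pi * N)"
      using h by (simp add: exp_minus field_simps)
    also have "\<dots> \<le> exp (real s) * exp (real s) * (sqrt pi * N)"
      using y2 N s_exp by (intro mult_right_mono mult_mono) auto
    also have "\<dots> = M\<^sup>2" by (simp add: M exp_add[symmetric])
    finally show ?thesis using M(1) by (rule power2_le_imp_le)
  qed
  have "cmod (\<Sum>j<s. a j * exp (\<i> * of_real (l j * x))) \<le> (2 ^ s * real ((n - s + s) choose s) - 1) * M"
  \<comment> \<open>Multiplying by \<open>w j\<close> moves the evaluation point by
    \<open>- x / n\<close>. The gap is \<open>m = n - s\<close>, so the sampled points are those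
    with \<open>n - s < k \<le> n\<close>.\<close>
  proof (rule turan_first_main_theorem[where w = "\<lambda>j. exp (\<i> * of_real (- (l j * x / real n)))"])
    fix k assume k: "n - s < k" "k \<le> n - s + s"
    have n0: "real n > 0" using sn s by simp
    have "(\<Sum>j<s. a j * exp (\<i> * of_real (l j * x)) * exp (\<i> * of_real (- (l j * x / real n))) ^ k)
        = f (x - real k * x / real n)"
      unfolding f_eq using n0
      by (simp add: exp_of_nat_mult[symmetric] mult.assoc exp_add[symmetric])
         (simp add: algebra_simps)
    moreover have "\<bar>x - real k * x / real n\<bar> \<le> h * sqrt (real s)"
    proof -
      have "x - real k * x / real n = x * ((real n - real k) / real n)"
        using n0 by (simp add: field_simps)
      then have "\<bar>x - real k * x / real n\<bar> = \<bar>x\<bar> * ((real n - real k) / real n)"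
        using k sn n0 by (simp add: abs_mult)
      also have "\<dots> \<le> \<bar>x\<bar> * (real s / (K * real s))"
        using k sn n0 n1 K s by (intro mult_left_mono frac_le) auto
      also have "\<dots> = h * sqrt (real s)" using K s by (simp add: xK)
      finally show ?thesis .
    qed
    ultimately show "cmod (\<Sum>j<s. a j * exp (\<i> * of_real (l j * x)) *
        exp (\<i> * of_real (- (l j * x / real n))) ^ k) \<le> M"
      using small by simp
  qed (use M in \<open>simp_all\<close>)
  then have "cmod (f x) \<le> (2 ^ s * real (n choose s) - 1) * M"
    using sn by (simp add: f_eq)
  also have "\<dots> \<le> (2 ^ s * 2 ^ n) * M"
  proof (rule mult_right_mono[OF _ M(1)])
    have "real (n choose s) \<le> real (2 ^ n)" by (simp only: of_nat_le_iff binomial_le_pow2)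
    then have "2 ^ s * real (n choose s) \<le> 2 ^ s * 2 ^ n" by (intro mult_left_mono) auto
    then show "2 ^ s * real (n choose s) - 1 \<le> 2 ^ s * 2 ^ n" by linarith
  qed
  finally have "(cmod (f x))\<^sup>2 \<le> (2 ^ s * 2 ^ n * M)\<^sup>2"
    by (intro power_mono) auto
  also have "\<dots> = 4 ^ (s + n) * M\<^sup>2"
    by (simp add: power_mult_distrib power_add flip: power_mult power2_eq_square)
       (simp add: power_mult mult.commute[of _ "2::nat"])
  also have "\<dots> \<le> exp (2 * (real s + real n)) * M\<^sup>2"
  proof (rule mult_right_mono)
    have "(4::real) \<le> exp 2"
    proof -
      have "(2::real) \<le> exp 1" using exp_ge_add_one_self[of 1] by simp
      then have "2 * 2 \<le> exp 1 * (exp 1 :: real)" by (intro mult_mono) auto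
      then show ?thesis by (simp flip: exp_add)
    qed
    then have "(4::real) ^ (s + n) \<le> exp 2 ^ (s + n)" by (intro power_mono) auto
    then show "(4::real) ^ (s + n) \<le> exp (2 * (real s + real n))"
      by (simp add: exp_of_nat_mult[symmetric] mult.commute)
  qed simp
  also have "\<dots> = exp (4 * real s + 2 * real n) * (sqrt pi * N)"
    unfolding M(2) by (simp add: exp_add[symmetric] algebra_simps)
  also have "\<dots> \<le> exp (x\<^sup>2 / (2 * h\<^sup>2)) * (sqrt pi * N)"
  proof (intro mult_right_mono)
    \<comment> \<open>The \<open>+ 1\<close> from rounding \<open>n\<close> up costs
      \<open>2 \<le> 2 s\<close>. The threshold 6 is the positive root of
      \<open>K^2 / 2 = 2 K + 6\<close>.\<close>
    have "4 * real s + 2 * real n \<le> real s * (2 * K + 6)"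
      using n2 s by (simp add: algebra_simps)
    also have "\<dots> \<le> real s * (K\<^sup>2 / 2)"
    proof (rule mult_left_mono)
      have "0 \<le> (K - 6) * (K + 2)" using K by simp
      then show "2 * K + 6 \<le> K\<^sup>2 / 2" by (simp add: algebra_simps power2_eq_square)
    qed simp
    also have "\<dots> = \<bar>x\<bar>\<^sup>2 / (2 * h\<^sup>2)"
      unfolding xK using h by (simp add: power_mult_distrib)
    finally show "exp (4 * real s + 2 * real n) \<le> exp (x\<^sup>2 / (2 * h\<^sup>2))" by simp
  qed (use N in auto)
  finally have "(cmod (f x))\<^sup>2 * normal_density 0 \<sigma> x \<le>
      exp (x\<^sup>2 / (2 * h\<^sup>2)) * (sqrt pi * N) * normal_density 0 \<sigma> x"
    by (intro mult_right_mono) auto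
  also have "\<dots> = 1 / h * (exp (x\<^sup>2 / (2 * h\<^sup>2)) * exp (- x\<^sup>2 / h\<^sup>2)) * N"
    unfolding g using h by (simp add: field_simps)
  also have "exp (x\<^sup>2 / (2 * h\<^sup>2)) * exp (- x\<^sup>2 / h\<^sup>2) = exp (- x\<^sup>2 / (4 * \<sigma>\<^sup>2))"
    using h \<sigma> by (simp add: exp_add[symmetric] h2 field_simps)
  finally show ?thesis by (simp add: h_def N_def)
qed

lemma leverage_score_le_gauss_score_bound:
  assumes "s \<ge> 1" and \<sigma>: "\<sigma> > 0"
  shows "leverage_score s (normal_density 0 \<sigma>) x \<le> ereal (gauss_score_bound s \<sigma> x)"
  unfolding leverage_score_def
proof (rule SUP_least)
  fix f assume "f \<in> {f \<in> sparse_fourier s. weighted_norm (normal_density 0 \<sigma>) f \<noteq> 0}"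
  then have f: "f \<in> sparse_fourier s" and pos: "(weighted_norm (normal_density 0 \<sigma>) f)\<^sup>2 > 0" by auto
  have "(cmod (f x))\<^sup>2 * normal_density 0 \<sigma> x \<le>
      gauss_score_bound s \<sigma> x * (weighted_norm (normal_density 0 \<sigma>) f)\<^sup>2"
    using sparse_fourier_central_bound[OF f \<sigma>, of x] sparse_fourier_tail_bound[OF f \<sigma> assms(1), of x]
    by (simp add: gauss_score_bound_def)
  then show "ereal ((cmod (f x))\<^sup>2 * normal_density 0 \<sigma> x / (weighted_norm (normal_density 0 \<sigma>) f)\<^sup>2)
      \<le> ereal (gauss_score_bound s \<sigma> x)"
    using pos by (simp add: pos_divide_le_eq)
qed

section \<open>Integral of the bound\<close>

text \<open>The two branches are dominated by a box on \<open>[-R, R]\<close> plus a full Gaussian.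
  The width of the box scales with \<open>\<sigma>\<close> and its height with
  \<open>1 / \<sigma>\<close>, so \<open>\<sigma>\<close> cancels and the box has area
  \<open>12 e s^(3/2)\<close>; the Gaussian has mass \<open>sqrt (2 pi)\<close>.\<close>

lemma integral_gauss_score_bound_le:
  assumes s: "s \<ge> 1" and \<sigma>: "\<sigma> > 0"
  shows "integrable lborel (gauss_score_bound s \<sigma>)"
    and "(LINT x|lborel. gauss_score_bound s \<sigma> x) \<le>
           (12 * exp 1 + sqrt (2 * pi)) * real s powr (3 / 2)"
proof -
  define R where "R = 6 * sqrt 2 * \<sigma> * sqrt (real s)"
  have R: "R \<ge> 0" using \<sigma> by (simp add: R_def)
  define G where "G x = exp 1 * real s / (sqrt 2 * \<sigma>) * indicator {-R..R} x +
      sqrt (2 * pi) * normal_density 0 (sqrt 2 * \<sigma>) x" for x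
  have Gi: "integrable lborel G"
    unfolding G_def using \<sigma> R by (intro Bochner_Integration.integrable_add integrable_mult_right
      integrable_real_indicator) auto
  \<comment> \<open>The tail branch is a multiple of the normal density of variance
    \<open>2 \<sigma>^2\<close>, whose total mass is known.\<close>
  have nd: "sqrt (2 * pi) * normal_density 0 (sqrt 2 * \<sigma>) x = 1 / (sqrt 2 * \<sigma>) * exp (- x\<^sup>2 / (4 * \<sigma>\<^sup>2))" for x
    using \<sigma> by (simp add: normal_density_def power_mult_distrib real_sqrt_mult real_div_sqrt field_simps)
  have le: "gauss_score_bound s \<sigma> x \<le> G x" and nn: "0 \<le> gauss_score_bound s \<sigma> x" for x
    using \<sigma> unfolding G_def nd gauss_score_bound_def R_def[symmetric]
    by (auto simp: indicator_def abs_le_iff algebra_simps)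
  have [measurable]: "gauss_score_bound s \<sigma> \<in> borel_measurable lborel"
    unfolding gauss_score_bound_def by measurable
  show int: "integrable lborel (gauss_score_bound s \<sigma>)"
    using Gi by (rule Bochner_Integration.integrable_bound) (use le nn in \<open>auto intro!: AE_I2 order_trans[OF le abs_ge_self]\<close>)
  have s1: "real s powr (3/2) \<ge> 1" using s by (intro ge_one_powr_ge_zero) auto
  have s32: "real s powr (3/2) = real s * sqrt (real s)"
  proof -
    have "real s powr (3/2) = real s powr (1 + 1/2)" by simp
    also have "\<dots> = real s * sqrt (real s)" using s by (subst powr_add) (simp add: powr_half_sqrt)
    finally show ?thesis .
  qed
  have "(LINT x|lborel. gauss_score_bound s \<sigma> x) \<le> (LINT x|lborel. G x)"
    using int Gi le by (intro integral_mono)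
  also have "\<dots> = exp 1 * real s / (sqrt 2 * \<sigma>) * (2 * R) + sqrt (2 * pi)"
    unfolding G_def using \<sigma> R
    by (subst Bochner_Integration.integral_add) (auto intro!: integrable_mult_right integrable_real_indicator)
  also have "\<dots> = 12 * exp 1 * real s powr (3/2) + sqrt (2 * pi)"
    using \<sigma> unfolding s32 R_def by (simp add: field_simps)
  also have "\<dots> \<le> 12 * exp 1 * real s powr (3/2) + sqrt (2 * pi) * real s powr (3/2)"
    using s1 by simp
  finally show "(LINT x|lborel. gauss_score_bound s \<sigma> x) \<le>
           (12 * exp 1 + sqrt (2 * pi)) * real s powr (3 / 2)"
    by (simp add: algebra_simps)
qed

theorem theorem1:
  shows "(\<forall>s::nat. \<forall>\<sigma>::real. s \<ge> 1 \<longrightarrow> \<sigma> > 0 \<longrightarrow>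
            (\<forall>x::real. leverage_score s (normal_density 0 \<sigma>) x \<le> ereal (gauss_score_bound s \<sigma> x)))
       \<and> (\<exists>C::real. \<forall>s::nat. \<forall>\<sigma>::real. s \<ge> 1 \<longrightarrow> \<sigma> > 0 \<longrightarrow>
            integrable lborel (gauss_score_bound s \<sigma>) \<and>
            (LINT x|lborel. gauss_score_bound s \<sigma> x) \<le> C * real s powr (3 / 2))"
  using leverage_score_le_gauss_score_bound integral_gauss_score_bound_le by blast

end
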